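(* Consider the contextual bilateral trade problem in the two-bit feedback model. There exists a profit-maximizing algorithm that achieves regret $O(d \log\log T + d\log d)$ and enforces per-round budget balance.
   Context: Contextual bilateral trade: Let $\mathbb{B}=\{w\in\mathbb{R}^d:\|w\|_2\le 1\}$. There are two fixed vectors $s,b\in\mathbb{B}$ unknown to the learner. At each time $t=1,\dots,T$, the learner observes a context $x_t\in\mathbb{B}$ (the contexts and $s,b$ are fixed in advance by an oblivious adversary; this is an instance), and posts a price $p_t$ to the seller and $q_t$ to the buyer. Valuations: $s_t=\langle s,x_t\rangle$, $b_t=\langle b,x_t\rangle$; the trade happens iff $s_t\le p_t$ and $q_t\le b_t$. Profit: $\mathrm{Profit}_t(p_t,q_t)=(q_t-p_t)\,\mathbb{1}\{s_t\le p_t\}\mathbb{1}\{q_t\le b_t\}$. Two-bit feedback: after each round the learner observes $(\mathbb{1}\{s_t\le p_t\},\mathbb{1}\{q_t\le b_t\})$. Regret of a (possibly randomized) profit-maximizing algorithm $\mathcal{A}$: $R_T(\mathcal{A})=\sup_{\mathcal{I}}\mathbb{E}\big[\sum_{t=1}^T (b_t-s_t)_+-\sum_{t=1}^T\mathrm{Profit}_t(p_t,q_t)\big]$. Per-round budget balance: $p_t\le q_t$ for every $t$. The $O(\cdot)$ hides absolute constants independent of $d$ and $T$. *)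

theory Defs
  imports "HOL-Probability.Probability"
begin

text \<open>Vectors of R^d are represented as functions nat => real that vanish
outside the first d coordinates.\<close>

type_synonym vec = "nat \<Rightarrow> real"

definition inner_d :: "nat \<Rightarrow> vec \<Rightarrow> vec \<Rightarrow> real" where
  "inner_d d u v = (\<Sum>i<d. u i * v i)"

definition in_ball :: "nat \<Rightarrow> vec \<Rightarrow> bool" where
  "in_ball d u \<longleftrightarrow> (\<Sum>i<d. (u i)^2) \<le> 1 \<and> (\<forall>i\<ge>d. u i = 0)"

text \<open>An instance (chosen in advance by an oblivious adversary): seller vector s,
buyer vector b and context sequence x (rounds indexed 0,1,2,...).\<close>
definition valid_instance :: "nat \<Rightarrow> vec \<Rightarrow> vec \<Rightarrow> (nat \<Rightarrow> vec) \<Rightarrow> bool" where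
  "valid_instance d s b x \<longleftrightarrow> in_ball d s \<and> in_ball d b \<and> (\<forall>t. in_ball d (x t))"

text \<open>A deterministic policy: at round t it receives the contexts x_0..x_t
and the two-bit feedback of rounds 0..t-1, and posts (p_t, q_t).\<close>
type_synonym policy = "nat \<Rightarrow> vec list \<Rightarrow> (bool \<times> bool) list \<Rightarrow> real \<times> real"

fun feedback_hist :: "nat \<Rightarrow> policy \<Rightarrow> vec \<Rightarrow> vec \<Rightarrow> (nat \<Rightarrow> vec) \<Rightarrow> nat \<Rightarrow> (bool \<times> bool) list" where
  "feedback_hist d pol s b x 0 = []"
| "feedback_hist d pol s b x (Suc t) =
     (let h = feedback_hist d pol s b x t;
          pq = pol t (map x [0..<Suc t]) h
      in h @ [(inner_d d s (x t) \<le> fst pq, snd pq \<le> inner_d d b (x t))])"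

definition prices :: "nat \<Rightarrow> policy \<Rightarrow> vec \<Rightarrow> vec \<Rightarrow> (nat \<Rightarrow> vec) \<Rightarrow> nat \<Rightarrow> real \<times> real" where
  "prices d pol s b x t = pol t (map x [0..<Suc t]) (feedback_hist d pol s b x t)"

definition profit :: "nat \<Rightarrow> policy \<Rightarrow> vec \<Rightarrow> vec \<Rightarrow> (nat \<Rightarrow> vec) \<Rightarrow> nat \<Rightarrow> real" where
  "profit d pol s b x t =
     (let (p, q) = prices d pol s b x t
      in if inner_d d s (x t) \<le> p \<and> q \<le> inner_d d b (x t) then q - p else 0)"

definition total_profit :: "nat \<Rightarrow> policy \<Rightarrow> vec \<Rightarrow> vec \<Rightarrow> (nat \<Rightarrow> vec) \<Rightarrow> nat \<Rightarrow> real" where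
  "total_profit d pol s b x T = (\<Sum>t<T. profit d pol s b x t)"

definition total_gft :: "nat \<Rightarrow> vec \<Rightarrow> vec \<Rightarrow> (nat \<Rightarrow> vec) \<Rightarrow> nat \<Rightarrow> real" where
  "total_gft d s b x T = (\<Sum>t<T. max 0 (inner_d d b (x t) - inner_d d s (x t)))"

text \<open>A randomized algorithm is a probability space M of random seeds together
with a deterministic policy alg w for every seed w.  Its regret on an instance:\<close>
definition regret_inst :: "nat \<Rightarrow> real measure \<Rightarrow> (real \<Rightarrow> policy) \<Rightarrow> vec \<Rightarrow> vec \<Rightarrow> (nat \<Rightarrow> vec) \<Rightarrow> nat \<Rightarrow> real" where
  "regret_inst d M alg s b x T =
     total_gft d s b x T - (\<integral>w. total_profit d (alg w) s b x T \<partial>M)"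

end

theory Submission
  imports Defs
begin

text \<open>The policy is deterministic and keeps, for each of s and b, the convex set K of all vectors
consistent with the feedback so far. Progress is measured by a weighted sum, over scales i up to
about log log T, of the logarithm of the volume of K fattened by a cube of half-side z_i, where
log (1 / z_i) is of order 2^i + log d and the weight is 12 / 2^i. Fattening bounds the total decrease
of the i-th term by O(d (2^i + log d) / 2^i), which sums to O(d log log T + d log d).

If K has width w in the direction of the context, of order between exp (- 2^(i+1)) and exp (- 2^i),
the price is chosen to cut off a fraction of order exp (- 2^i / 2) of the fattened volume at scale i.
An acceptance then costs at most w, and a refusal at most 2; in both cases the potential drops by as
much. That fattening does not spoil the cut rests on a bound for the volume of thin slabs of a convex
body, obtained from a homothety. A side whose width is below 1 / T is offered the price that it
certainly accepts.\<close>

section \<open>Lebesgue measure on the first d coordinates\<close>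

text \<open>Pushing the product measure forward along extension by zero puts d-dimensional Lebesgue
  measure on the type \<open>vec\<close> itself. It is concentrated on the vectors that vanish from
  coordinate d on, so sets that leave those coordinates free still get their d-dimensional
  volume.\<close>

definition vol :: "nat \<Rightarrow> vec measure" where
  "vol d = distr (\<Pi>\<^sub>M i\<in>{..<d}. (lborel :: real measure)) borel (\<lambda>f i. if i < d then f i else 0)"

lemma space_vol [simp]: "space (vol d) = UNIV"
  and sets_vol [simp, measurable_cong]: "sets (vol d) = sets borel"
  by (simp_all add: vol_def)

lemma measurable_extend_zero:
  "(\<lambda>f i. if i < d then f i else 0) \<in> measurable (\<Pi>\<^sub>M i\<in>{..<d}. (lborel :: real measure)) (borel :: vec measure)"
proof -
  have "(\<lambda>f i. if i < d then f i else 0) \<in> measurable (\<Pi>\<^sub>M i\<in>{..<d}. (lborel :: real measure))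
      (\<Pi>\<^sub>M i\<in>(UNIV :: nat set). (borel :: real measure))"
  proof (rule measurable_PiM_single')
    fix i :: nat
    show "(\<lambda>f. if i < d then f i else 0) \<in> borel_measurable (\<Pi>\<^sub>M i\<in>{..<d}. (lborel :: real measure))"
      by (cases "i < d") (auto intro!: measurable_component_singleton[THEN measurable_compose])
  qed auto
  then show ?thesis
    by (simp add: measurable_cong_sets[OF refl sets_PiM_equal_borel])
qed

lemma emeasure_vol:
  assumes "A \<in> sets borel"
  shows "emeasure (vol d) A = emeasure (\<Pi>\<^sub>M i\<in>{..<d}. (lborel :: real measure))
    ((\<lambda>f i. if i < d then f i else 0) -` A \<inter> space (\<Pi>\<^sub>M i\<in>{..<d}. (lborel :: real measure)))"
  unfolding vol_def using assms by (intro emeasure_distr measurable_extend_zero) auto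

interpretation lborel_prod: product_sigma_finite "\<lambda>_ :: nat. lborel :: real measure"
  by unfold_locales

lemma borel_measurable_coord [measurable]: "(\<lambda>y :: vec. y i) \<in> borel_measurable borel"
  by (intro borel_measurable_continuous_onI continuous_on_product_coordinates)

lemma borel_measurable_inner_d [measurable]: "(\<lambda>y. inner_d d y x) \<in> borel_measurable borel"
  unfolding inner_d_def by measurable

lemma emeasure_vol_box:
  assumes "\<And>i. i < d \<Longrightarrow> a i \<le> b i"
  shows "emeasure (vol d) {y. \<forall>i<d. a i < y i \<and> y i < b i} = ennreal (\<Prod>i<d. b i - a i)"
proof -
  have m: "{y :: vec. \<forall>i<d. a i < y i \<and> y i < b i} \<in> sets borel"
    by measurable
  have eq: "(\<lambda>f i. if i < d then f i else 0) -` {y. \<forall>i<d. a i < y i \<and> y i < b i}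
      \<inter> space (\<Pi>\<^sub>M i\<in>{..<d}. (lborel :: real measure)) = (\<Pi>\<^sub>E i\<in>{..<d}. {a i<..<b i})"
    by (auto simp: space_PiM PiE_def Pi_def)
  have "emeasure (vol d) {y. \<forall>i<d. a i < y i \<and> y i < b i}
      = (\<Prod>i<d. emeasure lborel {a i<..<b i})"
    unfolding emeasure_vol[OF m] eq by (rule lborel_prod.emeasure_PiM) auto
  also have "\<dots> = (\<Prod>i<d. ennreal (b i - a i))"
    using assms by (intro prod.cong) auto
  also have "\<dots> = ennreal (\<Prod>i<d. b i - a i)"
    using assms by (intro prod_ennreal) (simp add: less_imp_le)
  finally show ?thesis .
qed

section \<open>Scaling of the volume under homotheties\<close>

lemma emeasure_lborel_affine_vimage:
  fixes a t :: real
  assumes "0 < a" "B \<in> sets borel"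
  shows "ennreal a * emeasure lborel ((\<lambda>y. a * y + t) -` B) = emeasure lborel B"
proof -
  have "emeasure lborel B = emeasure (density (distr lborel borel (\<lambda>x. t + a * x)) (\<lambda>_. ennreal \<bar>a\<bar>)) B"
    using lborel_real_affine[of a t] assms by simp
  also have "\<dots> = ennreal a * emeasure lborel ((\<lambda>x. t + a * x) -` B)"
    using assms by (simp add: emeasure_density_const emeasure_distr)
  finally show ?thesis by (simp add: add.commute)
qed

lemma sets_borel_affine_vimage:
  assumes "A \<in> sets borel"
  shows "{y :: vec. (\<lambda>i. a * y i + t i) \<in> A} \<in> sets borel"
proof -
  have "continuous_on UNIV (\<lambda>y :: vec. (\<lambda>i. a * y i + t i))"
    by (intro continuous_on_coordinatewise_then_product continuous_intros
        continuous_on_product_coordinates)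
  from measurable_sets[OF borel_measurable_continuous_onI[OF this] assms] show ?thesis
    by (simp add: vimage_def)
qed

text \<open>The rescaled pushforward of the product measure agrees with it on boxes, by the
  one-dimensional case in each factor, and boxes determine a product measure. The condition on
  \<open>t\<close> makes the map commute with extension by zero.\<close>

lemma emeasure_vol_affine_vimage:
  assumes a: "0 < a" and A: "A \<in> sets borel" and t: "\<And>i. d \<le> i \<Longrightarrow> t i = 0"
  shows "ennreal (a ^ d) * emeasure (vol d) {y. (\<lambda>i. a * y i + t i) \<in> A} = emeasure (vol d) A"
proof -
  define P where "P = (\<Pi>\<^sub>M i\<in>{..<d}. (lborel :: real measure))"
  define \<psi> where "\<psi> f = (\<lambda>i\<in>{..<d}. a * f i + t i)" for f :: vec
  have \<psi>m: "\<psi> \<in> measurable P P"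
    unfolding P_def \<psi>_def by measurable
  have eq: "scale_measure (ennreal (a ^ d)) (distr P P \<psi>) = P"
  proof -
    have "scale_measure (ennreal (a ^ d)) (distr P P \<psi>) = (\<Pi>\<^sub>M i\<in>{..<d}. (lborel :: real measure))"
    proof (rule lborel_prod.PiM_eqI)
      fix B :: "nat \<Rightarrow> real set" assume "\<And>i. i \<in> {..<d} \<Longrightarrow> B i \<in> sets lborel"
      then have B: "\<And>i. i < d \<Longrightarrow> B i \<in> sets borel" by simp
      have BP: "Pi\<^sub>E {..<d} B \<in> sets P"
        unfolding P_def using B by (intro sets_PiM_I_finite) auto
      have pre: "\<psi> -` Pi\<^sub>E {..<d} B \<inter> space P = (\<Pi>\<^sub>E i\<in>{..<d}. (\<lambda>y. a * y + t i) -` B i)"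
        by (auto simp: P_def \<psi>_def space_PiM PiE_def Pi_def extensional_def)
      have meas: "(\<lambda>y. a * y + t i) -` B i \<in> sets lborel" if "i < d" for i
      proof -
        have "(\<lambda>y. a * y + t i) \<in> borel_measurable borel" by measurable
        from measurable_sets[OF this B[OF that]] show ?thesis by simp
      qed
      have "emeasure (scale_measure (ennreal (a ^ d)) (distr P P \<psi>)) (Pi\<^sub>E {..<d} B)
          = ennreal (a ^ d) * emeasure P (\<psi> -` Pi\<^sub>E {..<d} B \<inter> space P)"
        using \<psi>m BP by (simp add: emeasure_distr)
      also have "\<dots> = ennreal (a ^ d) * (\<Prod>i<d. emeasure lborel ((\<lambda>y. a * y + t i) -` B i))"
        unfolding pre unfolding P_def using meas by (subst lborel_prod.emeasure_PiM) auto
      also have "\<dots> = (\<Prod>i<d. ennreal a * emeasure lborel ((\<lambda>y. a * y + t i) -` B i))"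
        using a by (simp add: prod.distrib ennreal_power)
      also have "\<dots> = (\<Prod>i<d. emeasure lborel (B i))"
        using a B by (intro prod.cong emeasure_lborel_affine_vimage) auto
      finally show "emeasure (scale_measure (ennreal (a ^ d)) (distr P P \<psi>)) (Pi\<^sub>E {..<d} B)
          = (\<Prod>i\<in>{..<d}. emeasure lborel (B i))" .
    qed (auto simp: P_def)
    then show ?thesis by (simp add: P_def)
  qed
  define g :: "vec \<Rightarrow> vec" where "g = (\<lambda>f i. if i < d then f i else 0)"
  have gm: "g \<in> measurable P borel"
    unfolding g_def P_def by (rule measurable_extend_zero)
  have Am: "{y. (\<lambda>i. a * y i + t i) \<in> A} \<in> sets borel"
    by (rule sets_borel_affine_vimage[OF A])
  have g_\<psi>: "g (\<psi> f) = (\<lambda>i. a * g f i + t i)" for f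
    using t by (auto simp: g_def \<psi>_def fun_eq_iff)
  have "emeasure (vol d) A = emeasure P (g -` A \<inter> space P)"
    using emeasure_vol[OF A] by (simp add: g_def P_def)
  also have "\<dots> = emeasure (scale_measure (ennreal (a ^ d)) (distr P P \<psi>)) (g -` A \<inter> space P)"
    by (simp only: eq)
  also have "\<dots> = ennreal (a ^ d) * emeasure P (\<psi> -` (g -` A \<inter> space P) \<inter> space P)"
    using \<psi>m gm A by (simp add: emeasure_distr)
  also have "\<psi> -` (g -` A \<inter> space P) \<inter> space P = g -` {y. (\<lambda>i. a * y i + t i) \<in> A} \<inter> space P"
    using measurable_space[OF \<psi>m] by (auto simp: g_\<psi>)
  also have "emeasure P \<dots> = emeasure (vol d) {y. (\<lambda>i. a * y i + t i) \<in> A}"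
    using emeasure_vol[OF Am] by (simp add: g_def P_def)
  finally show ?thesis by simp
qed

section \<open>Slabs of convex sets\<close>

definition vconvex :: "vec set \<Rightarrow> bool" where
  "vconvex L \<longleftrightarrow> (\<forall>u\<in>L. \<forall>v\<in>L. \<forall>c. 0 < c \<longrightarrow> c \<le> 1 \<longrightarrow> (\<lambda>i. c * u i + (1 - c) * v i) \<in> L)"

lemma vconvexD:
  "vconvex L \<Longrightarrow> u \<in> L \<Longrightarrow> v \<in> L \<Longrightarrow> 0 < c \<Longrightarrow> c \<le> 1 \<Longrightarrow> (\<lambda>i. c * u i + (1 - c) * v i) \<in> L"
  by (auto simp: vconvex_def)

lemma inner_d_affine:
  "inner_d d (\<lambda>i. c * u i + e * v i) x = c * inner_d d u x + e * inner_d d v x"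
  by (simp add: inner_d_def sum_distrib_left sum.distrib algebra_simps)

lemma inner_d_uminus: "inner_d d v (\<lambda>i. - x i) = - inner_d d v x"
  by (simp add: inner_d_def sum_negf)

text \<open>The homothety towards P that maps the level \<open>\<alpha>\<close> to the level \<open>\<beta>\<close> sends the
part of L above \<open>\<alpha>\<close> into the part above \<open>\<beta>\<close>, hence off the slab.\<close>
lemma slab_bound:
  assumes L: "L \<in> sets borel" "emeasure (vol d) L < \<infinity>" "vconvex L"
    and P: "P \<in> L" "\<And>i. d \<le> i \<Longrightarrow> P i = 0" and \<alpha>\<beta>: "\<alpha> \<le> \<beta>" "\<beta> < inner_d d P x"
  shows "measure (vol d) {y \<in> L. \<alpha> < inner_d d y x \<and> inner_d d y x \<le> \<beta>}
    \<le> real d * ((\<beta> - \<alpha>) / (inner_d d P x - \<alpha>)) * measure (vol d) L"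
proof -
  let ?h = "\<lambda>y. inner_d d y x" and ?\<mu> = "measure (vol d)"
  define c where "c = (?h P - \<beta>) / (?h P - \<alpha>)"
  have c: "0 < c" "c \<le> 1" using \<alpha>\<beta> by (auto simp: c_def divide_simps)
  have c1: "1 - c = (\<beta> - \<alpha>) / (?h P - \<alpha>)"
    using \<alpha>\<beta> by (auto simp: c_def field_simps)
  have level: "c * \<alpha> + (1 - c) * ?h P = \<beta>"
  proof -
    have "c * (?h P - \<alpha>) = ?h P - \<beta>" using \<alpha>\<beta> by (simp add: c_def)
    then show ?thesis by (simp add: algebra_simps)
  qed
  define S where "S = {y \<in> L. \<alpha> < ?h y \<and> ?h y \<le> \<beta>}"
  define A where "A = {y \<in> L. \<alpha> < ?h y}"
  \<comment> \<open>\<open>B\<close> is the image of \<open>A\<close> under the homothety with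
    centre \<open>P\<close> and ratio \<open>c\<close>, written as a preimage under the inverse map
    so that the scaling lemma applies.\<close>
  define B where "B = {y. (\<lambda>i. (1 / c) * y i + (- (1 - c) / c * P i)) \<in> A}"
  have fin: "emeasure (vol d) X \<noteq> \<infinity>" if "X \<subseteq> L" for X
    using emeasure_mono[OF that, of "vol d"] L by (auto simp: top_unique)
  have A: "A \<in> sets borel" and S: "S \<in> sets borel"
    unfolding A_def S_def using L by measurable
  have B: "B \<in> sets borel"
    unfolding B_def by (rule sets_borel_affine_vimage[OF A])
  have AL: "A \<subseteq> L" by (auto simp: A_def)
  have Bsub: "B \<subseteq> {y \<in> A. \<beta> < ?h y}"
  proof
    fix y assume y: "y \<in> B"
    define u where "u = (\<lambda>i. (1 / c) * y i + (- (1 - c) / c * P i))"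
    have u: "u \<in> L" "\<alpha> < ?h u" using y by (auto simp: B_def A_def u_def)
    have yu: "y = (\<lambda>i. c * u i + (1 - c) * P i)"
      using c by (auto simp: u_def fun_eq_iff field_simps)
    have "y \<in> L" using vconvexD[OF L(3) u(1) P(1) c] by (simp add: yu)
    have "?h y = c * ?h u + (1 - c) * ?h P" unfolding yu by (rule inner_d_affine)
    moreover have "c * \<alpha> < c * ?h u" using u c by simp
    ultimately have "\<beta> < ?h y" using level by linarith
    with \<open>y \<in> L\<close> \<alpha>\<beta> show "y \<in> {y \<in> A. \<beta> < ?h y}" by (auto simp: A_def)
  qed
  have Bm: "?\<mu> B = c ^ d * ?\<mu> A"
  proof -
    have "ennreal ((1 / c) ^ d) * emeasure (vol d) B = emeasure (vol d) A"
      unfolding B_def using c A P by (intro emeasure_vol_affine_vimage) auto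
    then have "enn2real (ennreal ((1 / c) ^ d) * emeasure (vol d) B) = ?\<mu> A"
      by (simp add: measure_def)
    then have "(1 / c) ^ d * ?\<mu> B = ?\<mu> A"
      using c by (simp add: enn2real_mult measure_def)
    then show ?thesis using c by (simp add: field_simps power_divide)
  qed
  \<comment> \<open>The slab and the shrunken copy are disjoint parts of \<open>A\<close>, so the
    slab has at most the share \<open>1 - c ^ d\<close> that the shrinking loses. Bernoulli's
    inequality then makes this linear in \<open>1 - c\<close>.\<close>
  have "?\<mu> S + ?\<mu> B = ?\<mu> (S \<union> B)"
  proof (rule measure_Union[symmetric])
    show "emeasure (vol d) S \<noteq> \<infinity>" "emeasure (vol d) B \<noteq> \<infinity>"
      using Bsub AL by (auto intro!: fin simp only: S_def)
    show "S \<inter> B = {}" using Bsub unfolding S_def by auto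
  qed (use S B in simp_all)
  also have "\<dots> \<le> ?\<mu> A"
  proof (rule measure_mono_fmeasurable)
    show "S \<union> B \<subseteq> A" using Bsub unfolding S_def A_def by blast
    show "A \<in> fmeasurable (vol d)"
      using A fin[OF AL] by (simp add: fmeasurable_def top.not_eq_extremum)
  qed (use S B in simp)
  finally have 1: "?\<mu> S \<le> (1 - c ^ d) * ?\<mu> A" by (simp add: Bm algebra_simps)
  have "1 + real d * (c - 1) \<le> (1 + (c - 1)) ^ d"
    using c by (intro Bernoulli_inequality) auto
  then have 2: "1 - c ^ d \<le> real d * (1 - c)" by (simp add: algebra_simps)
  have 3: "?\<mu> A \<le> ?\<mu> L"
    using A L AL by (intro measure_mono_fmeasurable) (auto simp: fmeasurable_def)
  have "?\<mu> S \<le> (real d * (1 - c)) * ?\<mu> L"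
    using 1 mult_mono[OF 2 3] c by simp
  then show ?thesis by (simp add: S_def c1)
qed

section \<open>Knowledge sets and prices at a single scale\<close>

lemma in_ball_abs_le:
  assumes "in_ball d u" shows "\<bar>u i\<bar> \<le> 1"
proof (cases "i < d")
  case True
  have "(u i)\<^sup>2 \<le> (\<Sum>i<d. (u i)\<^sup>2)" using True by (intro member_le_sum) auto
  then have "(u i)\<^sup>2 \<le> 1" using assms by (simp add: in_ball_def)
  then show ?thesis by (simp add: abs_square_le_1)
qed (use assms in \<open>auto simp: in_ball_def\<close>)

lemma in_ball_uminus: "in_ball d x \<Longrightarrow> in_ball d (\<lambda>i. - x i)"
  by (simp add: in_ball_def)

text \<open>On the unit ball Cauchy-Schwarz follows by summing
  \<open>2 * \<bar>a * b\<bar> \<le> a\<^sup>2 + b\<^sup>2\<close> over the coordinates.\<close>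

lemma inner_d_abs_le:
  assumes "in_ball d u" "in_ball d v" shows "\<bar>inner_d d u v\<bar> \<le> 1"
proof -
  have "\<bar>inner_d d u v\<bar> \<le> (\<Sum>i<d. \<bar>u i * v i\<bar>)" unfolding inner_d_def by (rule sum_abs)
  also have "\<dots> \<le> (\<Sum>i<d. ((u i)\<^sup>2 + (v i)\<^sup>2) / 2)"
  proof (rule sum_mono)
    fix i
    have "0 \<le> (\<bar>u i\<bar> - \<bar>v i\<bar>)\<^sup>2" by simp
    then show "\<bar>u i * v i\<bar> \<le> ((u i)\<^sup>2 + (v i)\<^sup>2) / 2"
      by (simp add: power2_diff abs_mult)
  qed
  also have "\<dots> = ((\<Sum>i<d. (u i)\<^sup>2) + (\<Sum>i<d. (v i)\<^sup>2)) / 2"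
    by (simp add: sum.distrib sum_divide_distrib[symmetric])
  also have "\<dots> \<le> 1" using assms by (simp add: in_ball_def)
  finally show ?thesis .
qed

definition knowledge_set :: "nat \<Rightarrow> vec set \<Rightarrow> bool" where
  "knowledge_set d K \<longleftrightarrow> K \<noteq> {} \<and> vconvex K \<and> (\<forall>v\<in>K. in_ball d v)"

definition hi :: "nat \<Rightarrow> vec set \<Rightarrow> vec \<Rightarrow> real" where
  "hi d K x = (SUP v\<in>K. inner_d d v x)"

definition lo :: "nat \<Rightarrow> vec set \<Rightarrow> vec \<Rightarrow> real" where
  "lo d K x = (INF v\<in>K. inner_d d v x)"

lemma knowledge_set_bdd:
  assumes "knowledge_set d K" "in_ball d x"
  shows "bdd_above ((\<lambda>v. inner_d d v x) ` K)" "bdd_below ((\<lambda>v. inner_d d v x) ` K)"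
proof -
  have *: "- 1 \<le> inner_d d v x" "inner_d d v x \<le> 1" if "v \<in> K" for v
    using that assms inner_d_abs_le[of d v x] by (auto simp: knowledge_set_def abs_le_iff)
  show "bdd_above ((\<lambda>v. inner_d d v x) ` K)" using * by (auto intro: bdd_aboveI[of _ 1])
  show "bdd_below ((\<lambda>v. inner_d d v x) ` K)" using * by (auto intro: bdd_belowI[of _ "- 1"])
qed

lemma lo_le_inner_le_hi:
  assumes "knowledge_set d K" "in_ball d x" "v \<in> K"
  shows "lo d K x \<le> inner_d d v x" "inner_d d v x \<le> hi d K x"
  using knowledge_set_bdd[OF assms(1,2)] assms(3)
  by (auto simp: lo_def hi_def intro: cINF_lower cSUP_upper)

lemma hi_lo_bounds:
  assumes "knowledge_set d K" "in_ball d x"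
  shows "hi d K x \<le> 1" "- 1 \<le> lo d K x"
proof -
  have *: "- 1 \<le> inner_d d v x" "inner_d d v x \<le> 1" if "v \<in> K" for v
    using that assms inner_d_abs_le[of d v x] by (auto simp: knowledge_set_def abs_le_iff)
  have K: "K \<noteq> {}" using assms by (simp add: knowledge_set_def)
  show "hi d K x \<le> 1" unfolding hi_def using * by (intro cSUP_least K) auto
  show "- 1 \<le> lo d K x" unfolding lo_def using * by (intro cINF_greatest K) auto
qed

section \<open>Fattening by cubes and its volume\<close>

definition nbhd :: "nat \<Rightarrow> real \<Rightarrow> vec set \<Rightarrow> vec set" where
  "nbhd d z K = {y. \<exists>k\<in>K. \<forall>i<d. \<bar>y i - k i\<bar> < z}"

lemma nbhd_mono: "K' \<subseteq> K \<Longrightarrow> nbhd d z K' \<subseteq> nbhd d z K"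
  by (auto simp: nbhd_def)

lemma cube_eq: "{y. \<forall>i<d. \<bar>y i - k i\<bar> < z} = {y. \<forall>i<d. k i - z < y i \<and> y i < (k i :: real) + z}"
  by (auto simp: abs_diff_less_iff)

text \<open>A union of open cubes is open, whatever \<open>K\<close> is; this is why the cubes in
  \<open>nbhd\<close> are open.\<close>

lemma nbhd_borel [measurable]: "nbhd d z K \<in> sets borel"
proof -
  have "open {y :: vec. \<forall>i<d. \<bar>y i - k i\<bar> < z}" for k
  proof -
    have "open (\<Inter>i<d. {y :: vec. \<bar>y i - k i\<bar> < z})"
      by (intro open_INT ballI open_Collect_less continuous_intros continuous_on_product_coordinates) auto
    also have "(\<Inter>i<d. {y :: vec. \<bar>y i - k i\<bar> < z}) = {y. \<forall>i<d. \<bar>y i - k i\<bar> < z}" by auto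
    finally show ?thesis .
  qed
  then have "open (\<Union>k\<in>K. {y :: vec. \<forall>i<d. \<bar>y i - k i\<bar> < z})" by auto
  also have "(\<Union>k\<in>K. {y :: vec. \<forall>i<d. \<bar>y i - k i\<bar> < z}) = nbhd d z K" by (auto simp: nbhd_def)
  finally show ?thesis by auto
qed

lemma vconvex_nbhd:
  assumes "vconvex K" shows "vconvex (nbhd d z K)"
  unfolding vconvex_def
proof (intro ballI allI impI)
  fix u v and c :: real
  assume "u \<in> nbhd d z K" "v \<in> nbhd d z K" and c: "0 < c" "c \<le> 1"
  then obtain k l where k: "k \<in> K" "\<forall>i<d. \<bar>u i - k i\<bar> < z" and l: "l \<in> K" "\<forall>i<d. \<bar>v i - l i\<bar> < z"
    by (auto simp: nbhd_def)
  have "\<bar>(c * u i + (1 - c) * v i) - (c * k i + (1 - c) * l i)\<bar> < z" if "i < d" for i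
  proof -
    have "\<bar>(c * u i + (1 - c) * v i) - (c * k i + (1 - c) * l i)\<bar> = \<bar>c * (u i - k i) + (1 - c) * (v i - l i)\<bar>"
      by (simp add: algebra_simps)
    also have "\<dots> \<le> c * \<bar>u i - k i\<bar> + (1 - c) * \<bar>v i - l i\<bar>"
      using c by (intro order_trans[OF abs_triangle_ineq]) (simp add: abs_mult)
    also have "\<dots> < c * z + (1 - c) * z"
      using c k(2) l(2) that by (intro add_less_le_mono mult_left_mono) (auto simp: less_imp_le)
    finally show ?thesis by (simp add: algebra_simps)
  qed
  then show "(\<lambda>i. c * u i + (1 - c) * v i) \<in> nbhd d z K"
    unfolding nbhd_def by (intro CollectI bexI[OF _ vconvexD[OF assms k(1) l(1) c]]) auto
qed

lemma emeasure_nbhd_le: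
  assumes "\<forall>v\<in>K. in_ball d v" "0 < z"
  shows "emeasure (vol d) (nbhd d z K) \<le> ennreal ((2 + 2 * z) ^ d)"
proof -
  have "nbhd d z K \<subseteq> {y. \<forall>i<d. - 1 - z < y i \<and> y i < 1 + z}"
  proof
    fix y assume "y \<in> nbhd d z K"
    then obtain k where k: "k \<in> K" "\<forall>i<d. \<bar>y i - k i\<bar> < z" by (auto simp: nbhd_def)
    have "- 1 - z < y i \<and> y i < 1 + z" if "i < d" for i
      using in_ball_abs_le[of d k i] k that assms(1) by (smt (verit))
    then show "y \<in> {y. \<forall>i<d. - 1 - z < y i \<and> y i < 1 + z}" by simp
  qed
  then have "emeasure (vol d) (nbhd d z K) \<le> emeasure (vol d) {y. \<forall>i<d. - 1 - z < y i \<and> y i < 1 + z}"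
    by (intro emeasure_mono) auto
  also have "\<dots> = ennreal (\<Prod>i<d. (1 + z) - (- 1 - z))"
    using assms by (intro emeasure_vol_box) auto
  finally show ?thesis by (simp add: algebra_simps)
qed

lemma nbhd_fmeasurable:
  assumes "\<forall>v\<in>K. in_ball d v" "0 < z"
  shows "nbhd d z K \<in> fmeasurable (vol d)"
  using emeasure_nbhd_le[OF assms] by (auto simp: fmeasurable_def intro: order.strict_trans1)

lemma measure_nbhd_le:
  assumes "\<forall>v\<in>K. in_ball d v" "0 < z"
  shows "measure (vol d) (nbhd d z K) \<le> (2 + 2 * z) ^ d"
  using emeasure_nbhd_le[OF assms] assms(2) by (simp add: measure_def enn2real_leI)

text \<open>One cube around a point of \<open>K\<close> already has this volume. This is the purpose
  of fattening: the logarithm of the volume stays bounded below even if \<open>K\<close> shrinks to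
  a point.\<close>

lemma measure_nbhd_ge:
  assumes "\<forall>v\<in>K. in_ball d v" "0 < z" "K \<noteq> {}"
  shows "(2 * z) ^ d \<le> measure (vol d) (nbhd d z K)"
proof -
  obtain k where k: "k \<in> K" using assms by auto
  have sub: "{y. \<forall>i<d. k i - z < y i \<and> y i < k i + z} \<subseteq> nbhd d z K"
    using k unfolding cube_eq[symmetric] by (auto simp: nbhd_def)
  have "emeasure (vol d) {y. \<forall>i<d. k i - z < y i \<and> y i < k i + z} = ennreal (\<Prod>i<d. (k i + z) - (k i - z))"
    using assms by (intro emeasure_vol_box) auto
  also have "\<dots> = ennreal ((2 * z) ^ d)" by simp
  finally have "measure (vol d) {y. \<forall>i<d. k i - z < y i \<and> y i < k i + z} = (2 * z) ^ d"
    using assms(2) by (simp add: measure_def)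
  moreover have "measure (vol d) {y. \<forall>i<d. k i - z < y i \<and> y i < k i + z} \<le> measure (vol d) (nbhd d z K)"
    by (intro measure_mono_fmeasurable sub nbhd_fmeasurable assms) simp
  ultimately show ?thesis by simp
qed

text \<open>The coordinates of \<open>x\<close> are at most 1 in absolute value, so d coordinate
  errors below \<open>z\<close> add up to at most \<open>d * z\<close>; the factor 2 makes the bound
  strict.\<close>

lemma inner_d_near:
  assumes "in_ball d x" "\<forall>i<d. \<bar>y i - k i\<bar> < z" "0 < d"
  shows "\<bar>inner_d d y x - inner_d d k x\<bar> < 2 * real d * z"
proof -
  have z: "0 < z" using assms(2,3) by (auto intro: order.strict_trans1[OF abs_ge_zero])
  have "inner_d d y x - inner_d d k x = (\<Sum>i<d. (y i - k i) * x i)"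
    by (simp add: inner_d_def sum_subtractf left_diff_distrib)
  also have "\<bar>\<dots>\<bar> \<le> (\<Sum>i<d. \<bar>(y i - k i) * x i\<bar>)" by (rule sum_abs)
  also have "\<dots> \<le> (\<Sum>i<d. z * 1)"
    unfolding abs_mult using assms in_ball_abs_le[OF assms(1)] z
    by (intro sum_mono mult_mono) (auto simp: less_imp_le)
  also have "\<dots> < 2 * real d * z" using z assms(3) by simp
  finally show ?thesis .
qed

text \<open>\<open>slab_bound\<close> needs a point of the body well to one side of the slab. A slab
  thinner than half the width leaves more than a quarter of the width free above or below it, and a
  point of \<open>K\<close> nearly attaining \<open>hi\<close> or \<open>lo\<close> serves. The
  lower case is the upper one for the direction \<open>- x\<close>.\<close>

lemma slab_bound_width:
  assumes K: "knowledge_set d K" and x: "in_ball d x" and z: "0 < z"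
    and \<alpha>\<beta>: "\<alpha> < \<beta>" "2 * (\<beta> - \<alpha>) < hi d K x - lo d K x"
  shows "measure (vol d) {y \<in> nbhd d z K. \<alpha> < inner_d d y x \<and> inner_d d y x < \<beta>}
    \<le> real d * (4 * (\<beta> - \<alpha>) / (hi d K x - lo d K x)) * measure (vol d) (nbhd d z K)"
proof -
  define w where "w = hi d K x - lo d K x"
  define L where "L = nbhd d z K"
  have w: "0 < w" "2 * (\<beta> - \<alpha>) < w" using \<alpha>\<beta> by (auto simp: w_def)
  have Kne: "K \<noteq> {}" and Kb: "\<forall>v\<in>K. in_ball d v" and Kc: "vconvex K"
    using K by (auto simp: knowledge_set_def)
  have L: "L \<in> sets borel" "emeasure (vol d) L < \<infinity>" "vconvex L"
    using nbhd_fmeasurable[OF Kb z] vconvex_nbhd[OF Kc] by (auto simp: L_def fmeasurable_def)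
  have Lf: "L \<in> fmeasurable (vol d)" using nbhd_fmeasurable[OF Kb z] by (simp add: L_def)
  have KL: "K \<subseteq> L" unfolding L_def nbhd_def using z by (intro subsetI CollectI bexI) auto
  have out: "measure (vol d) {y \<in> L. \<alpha> < inner_d d y x \<and> inner_d d y x < \<beta>}
      \<le> real d * (4 * (\<beta> - \<alpha>) / w) * measure (vol d) L"
    if P: "P \<in> K" and S: "{y \<in> L. \<alpha> < inner_d d y x \<and> inner_d d y x < \<beta>}
        \<subseteq> {y \<in> L. a < inner_d d y x' \<and> inner_d d y x' \<le> b}"
      and ab: "b - a = \<beta> - \<alpha>" "w / 4 \<le> inner_d d P x' - a" "b < inner_d d P x'" for P x' a b
  proof -
    have "measure (vol d) {y \<in> L. \<alpha> < inner_d d y x \<and> inner_d d y x < \<beta>}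
        \<le> measure (vol d) {y \<in> L. a < inner_d d y x' \<and> inner_d d y x' \<le> b}"
      using L by (intro measure_mono_fmeasurable S fmeasurableI2[OF Lf]) auto
    also have "\<dots> \<le> real d * ((b - a) / (inner_d d P x' - a)) * measure (vol d) L"
      using L KL P Kb ab \<alpha>\<beta> by (intro slab_bound) (auto simp: in_ball_def)
    also have "\<dots> \<le> real d * (4 * (\<beta> - \<alpha>) / w) * measure (vol d) L"
    proof (intro mult_right_mono mult_left_mono)
      have "(b - a) / (inner_d d P x' - a) \<le> (\<beta> - \<alpha>) / (w / 4)"
        unfolding ab(1) using \<alpha>\<beta> w ab by (intro divide_left_mono) auto
      then show "(b - a) / (inner_d d P x' - a) \<le> 4 * (\<beta> - \<alpha>) / w" by (simp add: mult.commute)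
    qed auto
    finally show ?thesis .
  qed
  \<comment> \<open>The gaps above and below the slab add up to
    \<open>w - (\<beta> - \<alpha>)\<close>, so one of them is at least half of that.\<close>
  consider "(w - (\<beta> - \<alpha>)) / 2 \<le> hi d K x - \<beta>" | "(w - (\<beta> - \<alpha>)) / 2 \<le> \<alpha> - lo d K x"
    unfolding w_def by argo
  then have "measure (vol d) {y \<in> L. \<alpha> < inner_d d y x \<and> inner_d d y x < \<beta>}
      \<le> real d * (4 * (\<beta> - \<alpha>) / w) * measure (vol d) L"
  proof cases
    case 1
    \<comment> \<open>The supremum need not be attained. A loss of \<open>w / 8\<close> is
      affordable: \<open>P\<close> stays above the slab and at least \<open>w / 4\<close> above its
      lower edge.\<close>
    have "hi d K x - w / 8 < hi d K x" using w by simp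
    then obtain P where P: "P \<in> K" "hi d K x - w / 8 < inner_d d P x"
      using less_cSUP_iff[OF Kne knowledge_set_bdd(1)[OF K x]] unfolding hi_def by blast
    show ?thesis
      by (rule out[OF P(1), of \<alpha> x \<beta>]) (use 1 P w \<alpha>\<beta>(1) in \<open>auto simp: field_simps\<close>)
  next
    case 2
    have "lo d K x < lo d K x + w / 8" using w by simp
    then obtain P where P: "P \<in> K" "inner_d d P x < lo d K x + w / 8"
      using cINF_less_iff[OF Kne knowledge_set_bdd(2)[OF K x]] unfolding lo_def by blast
    show ?thesis
      by (rule out[OF P(1), of "- \<beta>" "\<lambda>i. - x i" "- \<alpha>"])
        (use 2 P w \<alpha>\<beta>(1) in \<open>auto simp: field_simps inner_d_uminus\<close>)
  qed
  then show ?thesis by (simp add: w_def L_def)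
qed

text \<open>Let \<open>a\<close> be, up to \<delta>, the \<epsilon>-quantile of the inner product on
  the fattened set, and \<open>p = a + \<delta>\<close>; fattening shifts inner products by less
  than \<delta>. After a sale everything at or below \<open>a\<close> is lost, a fraction of at
  least \<epsilon>. After a refusal there remain the part up to \<open>a - \<delta>\<close>, of
  fraction below \<epsilon>, and a slab of thickness \<open>3 * \<delta>\<close>, which the slab
  bound keeps within another \<epsilon>. The last hypothesis makes \<delta> small enough for
  that.\<close>

lemma price_exists:
  assumes K: "knowledge_set d K" and x: "in_ball d x" and z: "0 < z" and d: "1 \<le> d"
    and \<epsilon>: "0 < \<epsilon>" "2 * \<epsilon> < 1"
    and zw: "40 * (real d)\<^sup>2 * z \<le> \<epsilon> * (hi d K x - lo d K x)"
  obtains p where "lo d K x \<le> p" "p \<le> hi d K x"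
    "\<And>K'. K' \<subseteq> {v \<in> K. p \<le> inner_d d v x} \<Longrightarrow>
      measure (vol d) (nbhd d z K') \<le> (1 - \<epsilon>) * measure (vol d) (nbhd d z K)"
    "\<And>K'. K' \<subseteq> {v \<in> K. inner_d d v x < p} \<Longrightarrow>
      measure (vol d) (nbhd d z K') \<le> 2 * \<epsilon> * measure (vol d) (nbhd d z K)"
proof -
  let ?\<mu> = "measure (vol d)" and ?h = "\<lambda>y. inner_d d y x"
  define w where "w = hi d K x - lo d K x"
  define L where "L = nbhd d z K"
  define V where "V = ?\<mu> L"
  define \<delta> where "\<delta> = 2 * real d * z"
  have Kne: "K \<noteq> {}" and Kb: "\<forall>v\<in>K. in_ball d v" using K by (auto simp: knowledge_set_def)
  have Lf: "L \<in> fmeasurable (vol d)" using nbhd_fmeasurable[OF Kb z] by (simp add: L_def)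
  then have Lm [measurable]: "L \<in> sets borel" by (auto simp: fmeasurable_def)
  have sub_le: "?\<mu> X \<le> ?\<mu> Y" if "X \<subseteq> Y" "Y \<subseteq> L" "X \<in> sets borel" "Y \<in> sets borel" for X Y
    using that by (intro measure_mono_fmeasurable fmeasurableI2[OF Lf]) auto
  have V: "0 < V"
    using measure_nbhd_ge[OF Kb z Kne] z by (auto simp: V_def L_def intro: order.strict_trans2[rotated])
  have \<delta>: "0 < \<delta>" using d z by (simp add: \<delta>_def)
  have near: "\<exists>k\<in>K. \<bar>?h y - ?h k\<bar> < \<delta>" if "y \<in> L" for y
    using that inner_d_near[OF x, of y _ z] d unfolding L_def nbhd_def \<delta>_def by auto
  have hL: "lo d K x - \<delta> < ?h y" "?h y < hi d K x + \<delta>" if y: "y \<in> L" for y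
  proof -
    obtain k where "k \<in> K" "\<bar>?h y - ?h k\<bar> < \<delta>" using near[OF y] by auto
    then show "lo d K x - \<delta> < ?h y" "?h y < hi d K x + \<delta>"
      using lo_le_inner_le_hi[OF K x, of k] by linarith+
  qed
  define F where "F t = ?\<mu> {y \<in> L. ?h y \<le> t}" for t
  define t0 where "t0 = lo d K x - \<delta>"
  have F0: "F t0 = 0" using hL by (auto simp: F_def t0_def not_le[symmetric] cong: conj_cong)
  \<comment> \<open>The quantile is sought on a grid of mesh \<delta>, which avoids any appeal to
    continuity of \<open>F\<close>. The grid starts below all of \<open>L\<close>, where
    \<open>F\<close> is 0, so the least index is positive and has a predecessor.\<close>
  have "\<exists>n. \<epsilon> * V \<le> F (t0 + real n * \<delta>)"
  proof -
    obtain n :: nat where "(hi d K x + \<delta> - t0) / \<delta> < real n" using reals_Archimedean2 by blast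
    then have "hi d K x + \<delta> < t0 + real n * \<delta>" using \<delta> by (simp add: field_simps)
    then have "{y \<in> L. ?h y \<le> t0 + real n * \<delta>} = L" using hL(2) by (auto intro: order_trans less_imp_le)
    then have "F (t0 + real n * \<delta>) = V" by (simp add: F_def V_def)
    moreover have "\<epsilon> * V \<le> V" using \<epsilon> V by simp
    ultimately show ?thesis by auto
  qed
  then obtain n where n: "\<epsilon> * V \<le> F (t0 + real n * \<delta>)"
    and least: "\<And>m. m < n \<Longrightarrow> F (t0 + real m * \<delta>) < \<epsilon> * V"
    using exists_least_iff[of "\<lambda>n. \<epsilon> * V \<le> F (t0 + real n * \<delta>)"] by (auto simp: not_le)
  have "n \<noteq> 0" using n F0 mult_pos_pos[OF \<epsilon>(1) V] by (intro notI) simp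
  define a where "a = t0 + real n * \<delta>"
  have Fa: "\<epsilon> * V \<le> F a" using n by (simp add: a_def)
  have Fa': "F (a - \<delta>) < \<epsilon> * V"
    using least[of "n - 1"] \<open>n \<noteq> 0\<close> by (simp add: a_def of_nat_diff algebra_simps)
  define p where "p = a + \<delta>"
  have low: "?\<mu> (nbhd d z K') \<le> 2 * \<epsilon> * V" if "K' \<subseteq> {v \<in> K. ?h v \<le> p}" for K'
  proof -
    have sub: "nbhd d z K' \<subseteq> {y \<in> L. ?h y \<le> a - \<delta>} \<union> {y \<in> L. a - \<delta> < ?h y \<and> ?h y < a + 2 * \<delta>}"
    proof
      fix y assume "y \<in> nbhd d z K'"
      then obtain k where k: "k \<in> K'" "\<forall>i<d. \<bar>y i - k i\<bar> < z" by (auto simp: nbhd_def)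
      have "\<bar>?h y - ?h k\<bar> < \<delta>" unfolding \<delta>_def using d by (intro inner_d_near[OF x k(2)]) auto
      moreover have "?h k \<le> p" "y \<in> L" using k that by (auto simp: L_def nbhd_def)
      ultimately show "y \<in> {y \<in> L. ?h y \<le> a - \<delta>} \<union> {y \<in> L. a - \<delta> < ?h y \<and> ?h y < a + 2 * \<delta>}"
        by (auto simp: p_def)
    qed
    have w: "40 * (real d)\<^sup>2 * z \<le> \<epsilon> * w" using zw by (simp add: w_def)
    have dd: "real d \<le> (real d)\<^sup>2" using d by (simp add: power2_eq_square)
    have w0: "0 < w"
    proof -
      have "0 < 40 * (real d)\<^sup>2 * z" using d z by simp
      with w have "0 < \<epsilon> * w" by linarith
      with \<epsilon> show ?thesis by (simp add: zero_less_mult_iff)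
    qed
    have slab: "?\<mu> {y \<in> L. a - \<delta> < ?h y \<and> ?h y < a + 2 * \<delta>} \<le> \<epsilon> * V"
    proof -
      \<comment> \<open>The slab bound yields the factor
        \<open>24 * (real d)\<^sup>2 * z / w\<close>; the constant 40 in the hypothesis covers it
        with room to spare.\<close>
      have e: "(a + 2 * \<delta>) - (a - \<delta>) = 6 * real d * z" by (simp add: \<delta>_def)
      have "\<epsilon> * w < 1 / 2 * w" using \<epsilon> w0 by (intro mult_strict_right_mono) auto
      moreover have "12 * real d * z \<le> 40 * (real d)\<^sup>2 * z"
        using dd z by (intro mult_right_mono) linarith+
      ultimately have sm: "2 * (6 * real d * z) < w" using w w0 by linarith
      have "?\<mu> {y \<in> L. a - \<delta> < ?h y \<and> ?h y < a + 2 * \<delta>} \<le> real d * (4 * (6 * real d * z) / w) * V"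
        using slab_bound_width[OF K x z, of "a - \<delta>" "a + 2 * \<delta>"] \<delta> sm
        unfolding e by (simp add: w_def L_def V_def)
      also have "\<dots> \<le> \<epsilon> * V"
      proof (rule mult_right_mono)
        have "24 * (real d)\<^sup>2 * z \<le> 40 * (real d)\<^sup>2 * z" using z by (intro mult_right_mono) auto
        with w have "24 * (real d)\<^sup>2 * z \<le> \<epsilon> * w" by linarith
        then show "real d * (4 * (6 * real d * z) / w) \<le> \<epsilon>"
          using w0 by (simp add: field_simps power2_eq_square)
      qed (use V in simp)
      finally show ?thesis .
    qed
    have "?\<mu> (nbhd d z K') \<le> ?\<mu> ({y \<in> L. ?h y \<le> a - \<delta>} \<union> {y \<in> L. a - \<delta> < ?h y \<and> ?h y < a + 2 * \<delta>})"
      by (intro sub_le sub) auto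
    also have "\<dots> \<le> F (a - \<delta>) + ?\<mu> {y \<in> L. a - \<delta> < ?h y \<and> ?h y < a + 2 * \<delta>}"
      unfolding F_def by (intro measure_Un_le) auto
    finally show ?thesis using slab Fa' by simp
  qed
  have high: "?\<mu> (nbhd d z K') \<le> (1 - \<epsilon>) * V" if "K' \<subseteq> {v \<in> K. p \<le> ?h v}" for K'
  proof -
    have sub: "nbhd d z K' \<subseteq> L - {y \<in> L. ?h y \<le> a}"
    proof
      fix y assume "y \<in> nbhd d z K'"
      then obtain k where k: "k \<in> K'" "\<forall>i<d. \<bar>y i - k i\<bar> < z" by (auto simp: nbhd_def)
      have "\<bar>?h y - ?h k\<bar> < \<delta>" unfolding \<delta>_def using d by (intro inner_d_near[OF x k(2)]) auto
      moreover have "p \<le> ?h k" "y \<in> L" using k that by (auto simp: L_def nbhd_def)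
      ultimately show "y \<in> L - {y \<in> L. ?h y \<le> a}" by (auto simp: p_def)
    qed
    have "?\<mu> (nbhd d z K') \<le> ?\<mu> (L - {y \<in> L. ?h y \<le> a})"
      by (intro sub_le sub) auto
    also have "\<dots> = V - F a"
      unfolding V_def F_def using Lf
      by (intro measure_Diff) (auto simp: fmeasurable_def)
    finally show ?thesis using Fa by (simp add: algebra_simps)
  qed
  have "lo d K x \<le> p"
  proof -
    have "0 < F a" using Fa V \<epsilon> by (smt (verit) mult_pos_pos)
    then have "{y \<in> L. ?h y \<le> a} \<noteq> {}" unfolding F_def by (intro notI) simp
    then obtain y where "y \<in> L" "?h y \<le> a" by auto
    then obtain k where "k \<in> K" "\<bar>?h y - ?h k\<bar> < \<delta>" "?h y \<le> a" using near[of y] by auto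
    then show ?thesis using lo_le_inner_le_hi[OF K x, of k] by (simp add: p_def)
  qed
  moreover have "p \<le> hi d K x"
  proof (rule ccontr)
    \<comment> \<open>A price above \<open>hi\<close> would be refused by all of \<open>K\<close>,
      so \<open>K\<close> itself would have to obey the refusal bound, whose factor is below
      1.\<close>
    assume "\<not> p \<le> hi d K x"
    then have "K \<subseteq> {v \<in> K. ?h v \<le> p}" using lo_le_inner_le_hi[OF K x] by force
    from low[OF this] have "V \<le> 2 * \<epsilon> * V" by (simp add: V_def L_def)
    moreover have "2 * \<epsilon> * V < 1 * V" using \<epsilon> V by (intro mult_strict_right_mono) auto
    ultimately show False by simp
  qed
  moreover have "?\<mu> (nbhd d z K') \<le> 2 * \<epsilon> * V" if "K' \<subseteq> {v \<in> K. ?h v < p}" for K'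
    using that by (intro low) force
  ultimately show ?thesis using that[of p] high unfolding V_def L_def by blast
qed

section \<open>The potential\<close>

text \<open>The value solves \<open>40 * (real d)\<^sup>2 * z = exp (- 3 * 2 ^ i)\<close>. With
  \<open>n = 2 ^ i\<close>, \<open>price_exists\<close> tolerates \<open>\<epsilon> * w\<close> of
  at least \<open>3 * exp (- 5 * n / 2)\<close> at level i, which exceeds
  \<open>exp (- 3 * n)\<close>.\<close>

definition scale :: "nat \<Rightarrow> nat \<Rightarrow> real" where
  "scale d i = exp (- 3 * 2 ^ i) / (40 * (real d)\<^sup>2)"

definition level_vol :: "nat \<Rightarrow> nat \<Rightarrow> vec set \<Rightarrow> real" where
  "level_vol d i K = measure (vol d) (nbhd d (scale d i) K)"

text \<open>Level i serves the rounds in which the width of the knowledge set lies between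
  \<open>6 exp (- 2^(i+1))\<close> and \<open>6 exp (- 2^i)\<close>.\<close>
definition potential :: "nat \<Rightarrow> nat \<Rightarrow> vec set \<Rightarrow> real" where
  "potential d m K = (\<Sum>i\<le>m. 12 / 2 ^ i * ln (level_vol d i K))"

section \<open>Drops of the potential\<close>

lemma scale_pos: "1 \<le> d \<Longrightarrow> 0 < scale d i"
  by (simp add: scale_def)

lemma level_vol_pos:
  assumes "1 \<le> d" "K \<noteq> {}" "\<forall>v\<in>K. in_ball d v"
  shows "0 < level_vol d i K"
  using measure_nbhd_ge[OF assms(3) scale_pos[OF assms(1)] assms(2), of i] scale_pos[OF assms(1), of i]
  by (auto simp: level_vol_def intro: order.strict_trans2[rotated])

lemma level_vol_mono:
  assumes "1 \<le> d" "\<forall>v\<in>K. in_ball d v" "K' \<subseteq> K"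
  shows "level_vol d i K' \<le> level_vol d i K"
  unfolding level_vol_def using assms
  by (intro measure_mono_fmeasurable nbhd_mono nbhd_fmeasurable scale_pos) auto

lemma level_drop_nonneg:
  assumes "1 \<le> d" "\<forall>v\<in>K. in_ball d v" "K' \<subseteq> K" "K' \<noteq> {}"
  shows "0 \<le> 12 / 2 ^ i * (ln (level_vol d i K) - ln (level_vol d i K'))"
proof -
  have "0 < level_vol d i K'" using assms by (intro level_vol_pos) auto
  then have "ln (level_vol d i K') \<le> ln (level_vol d i K)"
    using level_vol_mono[OF assms(1-3), of i] by (intro ln_mono) auto
  then show ?thesis by simp
qed

lemma potential_diff:
  "potential d m K - potential d m K' =
    (\<Sum>i\<le>m. 12 / 2 ^ i * (ln (level_vol d i K) - ln (level_vol d i K')))"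
  by (simp add: potential_def sum_subtractf right_diff_distrib)

lemma potential_mono:
  assumes "1 \<le> d" "\<forall>v\<in>K. in_ball d v" "K' \<subseteq> K" "K' \<noteq> {}"
  shows "potential d m K' \<le> potential d m K"
proof -
  have "0 \<le> potential d m K - potential d m K'"
    unfolding potential_diff by (intro sum_nonneg level_drop_nonneg assms)
  then show ?thesis by simp
qed

text \<open>Every level's volume can only shrink, so the summands of the difference are nonnegative
  and progress at a single level bounds the total from below.\<close>

lemma potential_drop_ge:
  assumes "1 \<le> d" "\<forall>v\<in>K. in_ball d v" "K' \<subseteq> K" "K' \<noteq> {}" "i \<le> m"
    and r: "0 < r" "level_vol d i K' \<le> r * level_vol d i K"
  shows "12 / 2 ^ i * (- ln r) \<le> potential d m K - potential d m K'"
proof -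
  have pos: "0 < level_vol d i K'" "0 < level_vol d i K"
    using assms by (auto intro!: level_vol_pos)
  have "ln (level_vol d i K') \<le> ln (r * level_vol d i K)"
    using pos r by (intro ln_mono) auto
  also have "\<dots> = ln r + ln (level_vol d i K)" using pos r by (simp add: ln_mult)
  finally have "12 / 2 ^ i * (- ln r) \<le> 12 / 2 ^ i * (ln (level_vol d i K) - ln (level_vol d i K'))"
    by (intro mult_left_mono) auto
  also have "\<dots> \<le> potential d m K - potential d m K'"
    unfolding potential_diff using assms by (intro member_le_sum level_drop_nonneg) auto
  finally show ?thesis .
qed

text \<open>At level i the logarithm of the volume varies by at most
  \<open>d * ln (1 + 1 / z)\<close>, of order \<open>d * (2 ^ i + ln d + 1)\<close>. The weight
  \<open>12 / 2 ^ i\<close> turns the part \<open>3 * 2 ^ i\<close> into \<open>36 * d\<close> per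
  level, which gives the term in \<open>m\<close>; the rest is a geometric series with sum at most
  2.\<close>

lemma potential_range:
  assumes d: "1 \<le> d" and K: "\<forall>v\<in>K. in_ball d v" "K \<noteq> {}" and K': "\<forall>v\<in>K'. in_ball d v" "K' \<noteq> {}"
  shows "potential d m K - potential d m K' \<le> 12 * real d * (3 * (real m + 1) + 158 + 4 * ln (real d))"
proof -
  have lnd: "0 \<le> ln (real d)" using d by simp
  have level: "ln (level_vol d i K) - ln (level_vol d i K') \<le> real d * (79 + 2 * ln (real d) + 3 * 2 ^ i)" for i
  proof -
    let ?z = "scale d i"
    have z: "0 < ?z" by (rule scale_pos[OF d])
    have pos: "0 < level_vol d i K" using assms by (intro level_vol_pos) auto
    have "ln (level_vol d i K) \<le> ln ((2 + 2 * ?z) ^ d)"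
      using pos measure_nbhd_le[OF K(1) z] by (intro ln_mono) (auto simp: level_vol_def)
    moreover have "ln ((2 * ?z) ^ d) \<le> ln (level_vol d i K')"
      using z measure_nbhd_ge[OF K'(1) z K'(2)] by (intro ln_mono) (auto simp: level_vol_def)
    ultimately have "ln (level_vol d i K) - ln (level_vol d i K') \<le> real d * (ln (2 + 2 * ?z) - ln (2 * ?z))"
      using z ln_realpow[of "2 + 2 * ?z" d] ln_realpow[of "2 * ?z" d]
      by (simp add: right_diff_distrib del: power_mult_distrib)
    also have "ln (2 + 2 * ?z) - ln (2 * ?z) = ln ((2 + 2 * ?z) / (2 * ?z))"
      using z by (intro ln_divide_pos[symmetric]) auto
    also have "(2 + 2 * ?z) / (2 * ?z) = 1 + 1 / ?z" using z by (simp add: field_simps)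
    also have "ln (1 + 1 / ?z) \<le> ln (2 * (1 / ?z))"
    proof (rule ln_mono)
      have "exp (- 3 * 2 ^ i :: real) \<le> 1" by simp
      moreover have "1 \<le> 40 * (real d)\<^sup>2" using d by (smt (verit) one_le_power of_nat_1 of_nat_mono)
      ultimately have "exp (- 3 * 2 ^ i) \<le> 40 * (real d)\<^sup>2" by linarith
      then have "?z \<le> 1" unfolding scale_def using d by (simp add: divide_simps)
      then show "1 + 1 / ?z \<le> 2 * (1 / ?z)" using z by (simp add: field_simps)
    qed (use z in \<open>simp add: add_pos_pos\<close>)
    also have "2 * (1 / ?z) = 80 * ((real d)\<^sup>2 * exp (3 * 2 ^ i))"
      by (simp add: scale_def exp_minus field_simps)
    also have "ln (80 * ((real d)\<^sup>2 * exp (3 * 2 ^ i))) = ln 80 + (2 * ln (real d) + 3 * 2 ^ i)"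
      using d by (simp add: ln_mult ln_realpow)
    also have "\<dots> \<le> 79 + 2 * ln (real d) + 3 * 2 ^ i"
      using ln_le_minus_one[of "80 :: real"] by simp
    finally show ?thesis using d by simp
  qed
  have "potential d m K - potential d m K' \<le> (\<Sum>i\<le>m. 12 / 2 ^ i * (real d * (79 + 2 * ln (real d) + 3 * 2 ^ i)))"
    unfolding potential_diff by (intro sum_mono mult_left_mono level) auto
  also have "\<dots> = (\<Sum>i\<le>m. 12 * real d * (79 + 2 * ln (real d)) * (1 / 2) ^ i + 36 * real d)"
    by (intro sum.cong) (auto simp: field_simps)
  also have "\<dots> = 12 * real d * (79 + 2 * ln (real d)) * (\<Sum>i\<le>m. (1 / 2) ^ i) + 36 * real d * (real m + 1)"
    by (simp add: sum.distrib sum_distrib_left)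
  also have "\<dots> \<le> 12 * real d * (79 + 2 * ln (real d)) * 2 + 36 * real d * (real m + 1)"
  proof -
    have "(\<Sum>i\<le>m. (1 / 2 :: real) ^ i) \<le> 2" unfolding sum_gp0 by (simp add: divide_simps)
    then show ?thesis using lnd by (intro add_right_mono mult_left_mono) auto
  qed
  finally show ?thesis by (simp add: algebra_simps)
qed

text \<open>From the viewpoint of a buyer: an accepted price loses at most the width of
  \<open>K\<close>, while a refusal loses at most 2, since all values lie in \<open>[-1, 1]\<close>.
  The potential must pay for either, up to the tolerance \<theta>.\<close>

definition good_price :: "nat \<Rightarrow> nat \<Rightarrow> real \<Rightarrow> vec set \<Rightarrow> vec \<Rightarrow> real \<Rightarrow> bool" where
  "good_price d m \<theta> K x p \<longleftrightarrow> lo d K x \<le> p \<and> p \<le> hi d K x \<and>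
    (\<forall>K'. K' \<noteq> {} \<longrightarrow> K' \<subseteq> {v \<in> K. p \<le> inner_d d v x} \<longrightarrow>
      hi d K x - lo d K x - \<theta> \<le> potential d m K - potential d m K') \<and>
    (\<forall>K'. K' \<noteq> {} \<longrightarrow> K' \<subseteq> {v \<in> K. inner_d d v x < p} \<longrightarrow>
      2 \<le> potential d m K - potential d m K')"

text \<open>Since \<open>(1 + y / 4)\<^sup>2 - y\<close> is the square of \<open>1 - y / 4\<close>,
  it suffices to square \<open>1 + y / 4 \<le> exp (y / 4)\<close>.\<close>

lemma le_exp_half: "y \<le> exp (y / 2 :: real)"
proof -
  have "y \<le> (1 + y / 4)\<^sup>2"
    using zero_le_power2[of "1 - y / 4"] by (simp add: power2_eq_square algebra_simps)
  show ?thesis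
  proof (cases "0 \<le> y")
    case True
    have "(1 + y / 4)\<^sup>2 \<le> (exp (y / 4))\<^sup>2"
      using True exp_ge_add_one_self[of "y / 4"] by (intro power_mono) auto
    also have "\<dots> = exp (y / 2)" by (simp flip: exp_double)
    finally show ?thesis using \<open>y \<le> (1 + y / 4)\<^sup>2\<close> by simp
  next
    case False
    then show ?thesis using exp_gt_zero[of "y / 2"] by linarith
  qed
qed

text \<open>If the width is at most \<theta>, the price \<open>lo\<close> can only be accepted, and
  no drop is demanded. Otherwise the price is the one of \<open>price_exists\<close> at the level
  that matches the width; the hypothesis on \<theta> ensures that this level is at most
  \<open>m\<close>.\<close>

lemma good_price_exists:
  assumes d: "1 \<le> d" and K: "knowledge_set d K" and x: "in_ball d x"
    and \<theta>: "6 * exp (- (2 ^ Suc m)) \<le> \<theta>"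
  shows "\<exists>p. good_price d m \<theta> K x p"
proof (cases "hi d K x - lo d K x \<le> \<theta>")
  case True
  have Kb: "\<forall>v\<in>K. in_ball d v" and Kne: "K \<noteq> {}" using K by (auto simp: knowledge_set_def)
  have "lo d K x \<le> hi d K x"
    using Kne lo_le_inner_le_hi[OF K x] by (meson all_not_in_conv order_trans)
  moreover have "potential d m K' \<le> potential d m K" if "K' \<noteq> {}" "K' \<subseteq> {v \<in> K. lo d K x \<le> inner_d d v x}" for K'
    using that by (intro potential_mono d Kb) auto
  moreover have "{v \<in> K. inner_d d v x < lo d K x} = {}"
    using lo_le_inner_le_hi(1)[OF K x] by (auto simp: not_less)
  ultimately have "good_price d m \<theta> K x (lo d K x)"
    using True unfolding good_price_def by (smt (verit) subset_empty)
  then show ?thesis by blast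
next
  case False
  define w where "w = hi d K x - lo d K x"
  have Kb: "\<forall>v\<in>K. in_ball d v" and Kne: "K \<noteq> {}" using K by (auto simp: knowledge_set_def)
  have "6 * exp (- (2 ^ Suc m)) < w" using False \<theta> by (simp add: w_def)
  then obtain i where i: "6 * exp (- (2 ^ Suc i)) < w" and least: "\<And>j. j < i \<Longrightarrow> w \<le> 6 * exp (- (2 ^ Suc j))"
    using exists_least_iff[of "\<lambda>i. 6 * exp (- (2 ^ Suc i)) < w"] by (auto simp: not_less)
  have im: "i \<le> m" using least[of m] \<open>6 * exp (- (2 ^ Suc m)) < w\<close> by (cases "i \<le> m") auto
  have w6: "w \<le> 6 * exp (- (2 ^ i))"
  \<comment> \<open>For positive \<open>i\<close> this is minimality at \<open>i - 1\<close>. For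
    \<open>i = 0\<close> it holds because widths are at most 2 and \<open>exp 1 \<le> 3\<close>,
    which is where the constant 6 comes from.\<close>
  proof (cases i)
    case 0
    have "w \<le> 2" using hi_lo_bounds[OF K x] by (simp add: w_def)
    also have "2 \<le> 6 * exp (- 1 :: real)" using exp_le by (simp add: exp_minus field_simps)
    finally show ?thesis using 0 by simp
  qed (use least in auto)
  define n :: real where "n = 2 ^ i"
  have n: "1 \<le> n" by (simp add: n_def)
  \<comment> \<open>This balances the two outcomes: a refusal earns
    \<open>12 / n * (n / 2) = 6\<close>, and a sale earns at least
    \<open>12 / n * \<epsilon> = 6 * exp (- n / 2) / n\<close>, which is at least
    \<open>6 * exp (- n)\<close> and so covers the width.\<close>
  define \<epsilon> where "\<epsilon> = exp (- (n / 2)) / 2"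
  have \<epsilon>: "0 < \<epsilon>" "2 * \<epsilon> < 1" using n by (auto simp: \<epsilon>_def)
  have zw: "40 * (real d)\<^sup>2 * scale d i \<le> \<epsilon> * (hi d K x - lo d K x)"
  proof -
    have "40 * (real d)\<^sup>2 * scale d i = exp (- 3 * n)" using d by (simp add: scale_def n_def)
    also have "\<dots> \<le> exp (- (n / 2)) * exp (- (2 * n))" unfolding exp_add[symmetric] using n by simp
    also have "\<dots> \<le> \<epsilon> * (6 * exp (- (2 * n)))" by (simp add: \<epsilon>_def)
    also have "\<dots> \<le> \<epsilon> * w" using i \<epsilon> by (intro mult_left_mono) (auto simp: n_def)
    finally show ?thesis by (simp add: w_def)
  qed
  obtain p where p: "lo d K x \<le> p" "p \<le> hi d K x"
    and sale: "\<And>K'. K' \<subseteq> {v \<in> K. p \<le> inner_d d v x} \<Longrightarrow> level_vol d i K' \<le> (1 - \<epsilon>) * level_vol d i K"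
    and refuse: "\<And>K'. K' \<subseteq> {v \<in> K. inner_d d v x < p} \<Longrightarrow> level_vol d i K' \<le> 2 * \<epsilon> * level_vol d i K"
    using price_exists[OF K x scale_pos[OF d] d \<epsilon> zw] unfolding level_vol_def by blast
  have "w \<le> potential d m K - potential d m K'" if "K' \<noteq> {}" "K' \<subseteq> {v \<in> K. p \<le> inner_d d v x}" for K'
  proof -
    have "n * exp (- n) \<le> exp (- (n / 2))"
    proof -
      have "n * exp (- n) \<le> exp (n / 2) * exp (- n)" using le_exp_half[of n] by (intro mult_right_mono) auto
      then show ?thesis by (simp flip: exp_add)
    qed
    then have "6 * exp (- n) \<le> 12 / n * \<epsilon>" using n by (simp add: \<epsilon>_def field_simps)
    then have "w \<le> 12 / n * \<epsilon>" using w6 by (simp add: n_def)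
    also have "\<dots> \<le> 12 / n * (- ln (1 - \<epsilon>))"
      using n ln_le_minus_one[of "1 - \<epsilon>"] \<epsilon> by (intro mult_left_mono) auto
    also have "\<dots> \<le> potential d m K - potential d m K'"
      unfolding n_def using that \<epsilon> sale[OF that(2)] by (intro potential_drop_ge d Kb im) auto
    finally show ?thesis .
  qed
  moreover have "2 \<le> potential d m K - potential d m K'" if "K' \<noteq> {}" "K' \<subseteq> {v \<in> K. inner_d d v x < p}" for K'
  proof -
    have "2 \<le> 12 / n * (- ln (2 * \<epsilon>))" using n by (simp add: \<epsilon>_def)
    also have "\<dots> \<le> potential d m K - potential d m K'"
      unfolding n_def using that \<epsilon> refuse[OF that(2)] by (intro potential_drop_ge d Kb im) auto
    finally show ?thesis .
  qed
  moreover have "0 \<le> \<theta>" using \<theta> exp_gt_zero[of "- (2 ^ Suc m) :: real"] by linarith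
  ultimately have "good_price d m \<theta> K x p"
    using p unfolding good_price_def w_def by (smt (verit))
  then show ?thesis by blast
qed

section \<open>The trading policy\<close>

definition price :: "nat \<Rightarrow> nat \<Rightarrow> real \<Rightarrow> vec set \<Rightarrow> vec \<Rightarrow> real" where
  "price d m \<theta> K x = (SOME p. good_price d m \<theta> K x p)"

text \<open>The seller is a buyer for the context - x, whose value is the negated cost. If the two
  desired prices violate budget balance, posting the price of the side with the wider
  knowledge set to both sides still makes progress on that side.\<close>
definition quote :: "nat \<Rightarrow> nat \<Rightarrow> real \<Rightarrow> vec set \<Rightarrow> vec set \<Rightarrow> vec \<Rightarrow> real \<times> real" where
  "quote d m \<theta> Ks Kb x =
    (let x' = (\<lambda>i. - x i); p = - price d m \<theta> Ks x'; q = price d m \<theta> Kb x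
     in if p \<le> q then (p, q)
        else if hi d Kb x - lo d Kb x \<le> hi d Ks x' - lo d Ks x' then (p, p) else (q, q))"

definition seller_update :: "nat \<Rightarrow> vec set \<Rightarrow> vec \<Rightarrow> real \<Rightarrow> bool \<Rightarrow> vec set" where
  "seller_update d K x p f = {v \<in> K. (inner_d d v x \<le> p) = f}"

definition buyer_update :: "nat \<Rightarrow> vec set \<Rightarrow> vec \<Rightarrow> real \<Rightarrow> bool \<Rightarrow> vec set" where
  "buyer_update d K x q g = {v \<in> K. (q \<le> inner_d d v x) = g}"

text \<open>Comparing with \<open>f\<close> treats the closed half-space and its open complement
  together. In the open case strictness survives because \<open>c\<close> is positive.\<close>

lemma vconvex_cut:
  assumes "vconvex K"
  shows "vconvex {v \<in> K. (inner_d d v x \<le> p) = f}"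
  unfolding vconvex_def
proof (intro ballI allI impI)
  fix u v and c :: real
  assume uv: "u \<in> {v \<in> K. (inner_d d v x \<le> p) = f}" "v \<in> {v \<in> K. (inner_d d v x \<le> p) = f}"
    and c: "0 < c" "c \<le> 1"
  have h: "inner_d d (\<lambda>i. c * u i + (1 - c) * v i) x = c * inner_d d u x + (1 - c) * inner_d d v x"
    by (rule inner_d_affine)
  have pc: "p = c * p + (1 - c) * p" by (simp add: algebra_simps)
  have "(inner_d d (\<lambda>i. c * u i + (1 - c) * v i) x \<le> p) = f"
  proof (cases f)
    case True
    then have "c * inner_d d u x + (1 - c) * inner_d d v x \<le> c * p + (1 - c) * p"
      using uv c by (intro add_mono mult_left_mono) auto
    then show ?thesis using True pc h by simp
  next
    case False
    then have "c * p + (1 - c) * p < c * inner_d d u x + (1 - c) * inner_d d v x"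
      using uv c by (intro add_less_le_mono mult_left_mono mult_strict_left_mono) auto
    then show ?thesis using False pc h by simp
  qed
  then show "(\<lambda>i. c * u i + (1 - c) * v i) \<in> {v \<in> K. (inner_d d v x \<le> p) = f}"
    using vconvexD[OF assms _ _ c] uv by auto
qed

text \<open>The true vector agrees with its own feedback, so the cut stays nonempty. A buyer cut is
  a seller cut for the context \<open>- x\<close> and the price \<open>- q\<close>.\<close>

lemma knowledge_set_update:
  assumes "knowledge_set d K" "v \<in> K"
  shows "knowledge_set d (seller_update d K x p (inner_d d v x \<le> p))"
    and "knowledge_set d (buyer_update d K x q (q \<le> inner_d d v x))"
proof -
  have K: "vconvex K" "\<forall>v\<in>K. in_ball d v" using assms by (auto simp: knowledge_set_def)
  show "knowledge_set d (seller_update d K x p (inner_d d v x \<le> p))"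
    using assms K vconvex_cut[OF K(1), of d x p "inner_d d v x \<le> p"]
    by (auto simp: knowledge_set_def seller_update_def)
  have eq: "buyer_update d K x q g = {v \<in> K. (inner_d d v (\<lambda>i. - x i) \<le> - q) = g}" for g
    by (auto simp: buyer_update_def inner_d_uminus)
  show "knowledge_set d (buyer_update d K x q (q \<le> inner_d d v x))"
    using assms K vconvex_cut[OF K(1), of d "\<lambda>i. - x i" "- q" "q \<le> inner_d d v x"]
    unfolding eq by (auto simp: knowledge_set_def inner_d_uminus)
qed

lemma quote_budget_balance: "fst (quote d m \<theta> Ks Kb x) \<le> snd (quote d m \<theta> Ks Kb x)"
  by (simp add: quote_def Let_def)

text \<open>With \<open>P\<close> and \<open>Q\<close> the two desired prices, the gain from trade
  is \<open>(b - Q) + (Q - P) + (P - s)\<close> in terms of the values. If both are posted and a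
  trade happens, the loss is at most the sum of the widths, paid by the two drops. If
  \<open>Q < P\<close>, the profit is 0 and the gain is at most twice the larger width, which
  explains the factor 2; an acceptance by the wider side pays for it. In every other case some side
  refused its desired price, and that drop of 2 covers any loss.\<close>

lemma round_regret:
  assumes d: "1 \<le> d" and \<theta>: "6 * exp (- (2 ^ Suc m)) \<le> \<theta>" and x: "in_ball d x"
    and Ks: "knowledge_set d Ks" and Kb: "knowledge_set d Kb" and s: "s \<in> Ks" and b: "b \<in> Kb"
    and pq: "quote d m \<theta> Ks Kb x = (p, q)"
  defines "f \<equiv> inner_d d s x \<le> p" and "g \<equiv> q \<le> inner_d d b x"
  shows "max 0 (inner_d d b x - inner_d d s x) - (if f \<and> g then q - p else 0)
    \<le> 2 * ((potential d m Ks - potential d m (seller_update d Ks x p f))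
         + (potential d m Kb - potential d m (buyer_update d Kb x q g))) + 2 * \<theta>"
proof -
  define x' where "x' = (\<lambda>i. - x i)"
  define P where "P = - price d m \<theta> Ks x'"
  define Q where "Q = price d m \<theta> Kb x"
  define ws where "ws = hi d Ks x' - lo d Ks x'"
  define wb where "wb = hi d Kb x - lo d Kb x"
  define Ds where "Ds = potential d m Ks - potential d m (seller_update d Ks x p f)"
  define Db where "Db = potential d m Kb - potential d m (buyer_update d Kb x q g)"
  let ?s = "inner_d d s x" and ?b = "inner_d d b x"
  have x': "in_ball d x'" unfolding x'_def by (rule in_ball_uminus[OF x])
  have sx': "inner_d d v x' = - inner_d d v x" for v unfolding x'_def by (rule inner_d_uminus)
  \<comment> \<open>In the negated problem the seller accepts \<open>P\<close> exactly if the value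
    for \<open>- x\<close> is at least \<open>- P\<close>.\<close>
  have gs: "good_price d m \<theta> Ks x' (- P)"
    unfolding P_def price_def using someI_ex[OF good_price_exists[OF d Ks x' \<theta>]] by simp
  have gb: "good_price d m \<theta> Kb x Q"
    unfolding Q_def price_def using someI_ex[OF good_price_exists[OF d Kb x \<theta>]] by simp
  have cases: "(P \<le> Q \<and> p = P \<and> q = Q) \<or> (Q < P \<and> wb \<le> ws \<and> p = P \<and> q = P)
      \<or> (Q < P \<and> ws < wb \<and> p = Q \<and> q = Q)"
    using pq unfolding quote_def Let_def x'_def[symmetric] P_def[symmetric] Q_def[symmetric]
      ws_def[symmetric] wb_def[symmetric] by (auto split: if_splits)
  have su: "s \<in> seller_update d Ks x p f" "seller_update d Ks x p f \<subseteq> Ks"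
    using s by (auto simp: seller_update_def f_def)
  have bu: "b \<in> buyer_update d Kb x q g" "buyer_update d Kb x q g \<subseteq> Kb"
    using b by (auto simp: buyer_update_def g_def)
  have Ds0: "0 \<le> Ds" unfolding Ds_def using potential_mono[OF d _ su(2), of m] su(1) Ks
    by (auto simp: knowledge_set_def)
  have Db0: "0 \<le> Db" unfolding Db_def using potential_mono[OF d _ bu(2), of m] bu(1) Kb
    by (auto simp: knowledge_set_def)
  have Ds1: "ws - \<theta> \<le> Ds" if "p = P" f
  proof -
    have "seller_update d Ks x p f \<subseteq> {v \<in> Ks. - P \<le> inner_d d v x'}"
      using that by (auto simp: seller_update_def sx')
    moreover have "seller_update d Ks x p f \<noteq> {}" using su(1) by blast
    ultimately show ?thesis using gs unfolding good_price_def ws_def Ds_def by blast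
  qed
  have Ds2: "2 \<le> Ds" if "p = P" "\<not> f"
  proof -
    have "seller_update d Ks x p f \<subseteq> {v \<in> Ks. inner_d d v x' < - P}"
      using that by (auto simp: seller_update_def sx')
    moreover have "seller_update d Ks x p f \<noteq> {}" using su(1) by blast
    ultimately show ?thesis using gs unfolding good_price_def Ds_def by blast
  qed
  have Db1: "wb - \<theta> \<le> Db" if "q = Q" g
  proof -
    have "buyer_update d Kb x q g \<subseteq> {v \<in> Kb. Q \<le> inner_d d v x}"
      using that by (auto simp: buyer_update_def)
    moreover have "buyer_update d Kb x q g \<noteq> {}" using bu(1) by blast
    ultimately show ?thesis using gb unfolding good_price_def wb_def Db_def by blast
  qed
  have Db2: "2 \<le> Db" if "q = Q" "\<not> g"
  proof -
    have "buyer_update d Kb x q g \<subseteq> {v \<in> Kb. inner_d d v x < Q}"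
      using that by (auto simp: buyer_update_def)
    moreover have "buyer_update d Kb x q g \<noteq> {}" using bu(1) by blast
    ultimately show ?thesis using gb unfolding good_price_def Db_def by blast
  qed
  have wsb: "P - ?s \<le> ws" "?b - Q \<le> wb"
    using lo_le_inner_le_hi[OF Ks x' s] lo_le_inner_le_hi[OF Kb x b] gs gb
    by (auto simp: good_price_def ws_def wb_def sx')
  have w0: "0 \<le> ws" "0 \<le> wb"
    using gs gb by (auto simp: good_price_def ws_def wb_def)
  have \<theta>0: "0 \<le> \<theta>" using \<theta> exp_gt_zero[of "- (2 ^ Suc m) :: real"] by linarith
  have sb: "\<bar>?s\<bar> \<le> 1" "\<bar>?b\<bar> \<le> 1"
    using inner_d_abs_le s b x Ks Kb by (auto simp: knowledge_set_def)
  have "max 0 (?b - ?s) - (if f \<and> g then q - p else 0) \<le> 2 * (Ds + Db) + 2 * \<theta>"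
    using cases
  proof (elim disjE conjE)
    assume *: "P \<le> Q" "p = P" "q = Q"
    show ?thesis
    proof (cases "f \<and> g")
      case True
      then have "?s \<le> P" "Q \<le> ?b" using * by (auto simp: f_def g_def)
      then show ?thesis using True Ds1 Db1 * wsb w0 Ds0 Db0 \<theta>0 by auto
    next
      case False
      then have "2 \<le> Ds + Db" using Ds2 Db2 * Ds0 Db0 by fastforce
      then show ?thesis using False sb \<theta>0 by auto
    qed
  next
    assume *: "Q < P" "wb \<le> ws" "p = P" "q = P"
    show ?thesis
    proof (cases f)
      case True
      then show ?thesis using Ds1 * wsb w0 Ds0 Db0 \<theta>0 by auto
    next
      case False
      then show ?thesis using Ds2 * Db0 sb \<theta>0 by auto
    qed
  next
    assume *: "Q < P" "ws < wb" "p = Q" "q = Q"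
    show ?thesis
    proof (cases g)
      case True
      then show ?thesis using Db1 * wsb w0 Ds0 Db0 \<theta>0 by auto
    next
      case False
      then show ?thesis using Db2 * Ds0 sb \<theta>0 by auto
    qed
  qed
  then show ?thesis by (simp add: Ds_def Db_def)
qed

section \<open>The state of the policy and the regret of a run\<close>

fun refine :: "nat \<Rightarrow> nat \<Rightarrow> real \<Rightarrow> vec set \<times> vec set \<Rightarrow> vec \<times> bool \<times> bool \<Rightarrow> vec set \<times> vec set" where
  "refine d m \<theta> (Ks, Kb) (x, f, g) =
    (let (p, q) = quote d m \<theta> Ks Kb x in (seller_update d Ks x p f, buyer_update d Kb x q g))"

text \<open>A policy is a function of the history, so the state is recomputed by replaying it. At
  round t there are t + 1 contexts but only t feedback pairs; \<open>zip\<close> drops the current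
  context, which \<open>trade_policy\<close> takes as \<open>last xs\<close>.\<close>

definition knowledge :: "nat \<Rightarrow> nat \<Rightarrow> real \<Rightarrow> vec list \<Rightarrow> (bool \<times> bool) list \<Rightarrow> vec set \<times> vec set" where
  "knowledge d m \<theta> xs h = foldl (refine d m \<theta>) ({v. in_ball d v}, {v. in_ball d v}) (zip xs h)"

definition trade_policy :: "nat \<Rightarrow> nat \<Rightarrow> real \<Rightarrow> policy" where
  "trade_policy d m \<theta> t xs h = (let (Ks, Kb) = knowledge d m \<theta> xs h in quote d m \<theta> Ks Kb (last xs))"

lemma knowledge_set_ball: "knowledge_set d {v. in_ball d v}"
proof -
  have "(\<lambda>_. 0) \<in> {v. in_ball d v}" by (simp add: in_ball_def)
  moreover have "vconvex {v. in_ball d v}"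
    unfolding vconvex_def
  proof (intro ballI allI impI)
    fix u v and c :: real
    assume uv: "u \<in> {v. in_ball d v}" "v \<in> {v. in_ball d v}" and c: "0 < c" "c \<le> 1"
    have "(c * u i + (1 - c) * v i)\<^sup>2 \<le> c * (u i)\<^sup>2 + (1 - c) * (v i)\<^sup>2" for i
    proof -
      have "c * (u i)\<^sup>2 + (1 - c) * (v i)\<^sup>2 - (c * u i + (1 - c) * v i)\<^sup>2 = c * (1 - c) * (u i - v i)\<^sup>2"
        by (simp add: power2_eq_square algebra_simps)
      moreover have "0 \<le> c * (1 - c) * (u i - v i)\<^sup>2" using c by simp
      ultimately show ?thesis by linarith
    qed
    then have "(\<Sum>i<d. (c * u i + (1 - c) * v i)\<^sup>2) \<le> (\<Sum>i<d. c * (u i)\<^sup>2 + (1 - c) * (v i)\<^sup>2)"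
      by (intro sum_mono)
    also have "\<dots> = c * (\<Sum>i<d. (u i)\<^sup>2) + (1 - c) * (\<Sum>i<d. (v i)\<^sup>2)"
      by (simp add: sum.distrib sum_distrib_left)
    also have "\<dots> \<le> c * 1 + (1 - c) * 1"
      using uv c by (intro add_mono mult_left_mono) (auto simp: in_ball_def)
    finally show "(\<lambda>i. c * u i + (1 - c) * v i) \<in> {v. in_ball d v}"
      using uv by (simp add: in_ball_def)
  qed
  ultimately show ?thesis by (auto simp: knowledge_set_def)
qed

lemma length_feedback_hist [simp]: "length (feedback_hist d pol s b x t) = t"
  by (induction t) (auto simp: Let_def)

text \<open>The true vectors stay in the knowledge sets, so \<open>round_regret\<close> applies in
  every round and the potential differences telescope. The constant 48 is 2 from
  \<open>round_regret\<close>, times two sides, times 12 from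
  \<open>potential_range\<close>.\<close>

lemma regret_bound:
  assumes d: "1 \<le> d" and \<theta>: "6 * exp (- (2 ^ Suc m)) \<le> \<theta>" and inst: "valid_instance d s b x"
  shows "total_gft d s b x T - total_profit d (trade_policy d m \<theta>) s b x T
    \<le> 48 * real d * (3 * (real m + 1) + 158 + 4 * ln (real d)) + 2 * \<theta> * real T"
proof -
  let ?pol = "trade_policy d m \<theta>"
  define St where "St t = knowledge d m \<theta> (map x [0..<t]) (feedback_hist d ?pol s b x t)" for t
  have prices: "prices d ?pol s b x t = quote d m \<theta> (fst (St t)) (snd (St t)) (x t)" for t
    by (simp add: prices_def trade_policy_def St_def knowledge_def zip_append1 split_beta)
  have St_Suc: "St (Suc t) = refine d m \<theta> (St t)
      (x t, inner_d d s (x t) \<le> fst (prices d ?pol s b x t), snd (prices d ?pol s b x t) \<le> inner_d d b (x t))" for t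
    by (simp add: St_def knowledge_def Let_def prices_def)
  have xb: "in_ball d (x t)" for t using inst by (simp add: valid_instance_def)
  have inv: "knowledge_set d (fst (St t)) \<and> knowledge_set d (snd (St t)) \<and> s \<in> fst (St t) \<and> b \<in> snd (St t)" for t
  proof (induction t)
    case 0
    then show ?case using inst knowledge_set_ball by (simp add: St_def knowledge_def valid_instance_def)
  next
    case (Suc t)
    obtain Ks Kb where S: "St t = (Ks, Kb)" by fastforce
    obtain p q where pq: "prices d ?pol s b x t = (p, q)" by fastforce
    have qu: "quote d m \<theta> Ks Kb (x t) = (p, q)" using prices[of t] S pq by simp
    have "St (Suc t) = (seller_update d Ks (x t) p (inner_d d s (x t) \<le> p),
        buyer_update d Kb (x t) q (q \<le> inner_d d b (x t)))"
      by (simp add: St_Suc S pq qu)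
    then show ?case using Suc knowledge_set_update S by (simp add: seller_update_def buyer_update_def)
  qed
  define \<Psi> where "\<Psi> t = potential d m (fst (St t)) + potential d m (snd (St t))" for t
  have step: "max 0 (inner_d d b (x t) - inner_d d s (x t)) - profit d ?pol s b x t
      \<le> 2 * (\<Psi> t - \<Psi> (Suc t)) + 2 * \<theta>" for t
  proof -
    obtain Ks Kb where S: "St t = (Ks, Kb)" by fastforce
    obtain p q where pq: "prices d ?pol s b x t = (p, q)" by fastforce
    have qu: "quote d m \<theta> Ks Kb (x t) = (p, q)" using prices[of t] S pq by simp
    have "St (Suc t) = (seller_update d Ks (x t) p (inner_d d s (x t) \<le> p),
        buyer_update d Kb (x t) q (q \<le> inner_d d b (x t)))"
      by (simp add: St_Suc S pq qu)
    then show ?thesis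
      using round_regret[OF d \<theta> xb[of t] _ _ _ _ qu, of s b] inv[of t] S
      by (simp add: \<Psi>_def profit_def pq)
  qed
  have "total_gft d s b x T - total_profit d ?pol s b x T \<le> 2 * (\<Psi> 0 - \<Psi> T) + 2 * \<theta> * real T"
  proof -
    have "total_gft d s b x T - total_profit d ?pol s b x T
        = (\<Sum>t<T. max 0 (inner_d d b (x t) - inner_d d s (x t)) - profit d ?pol s b x t)"
      by (simp add: total_gft_def total_profit_def sum_subtractf)
    also have "\<dots> \<le> (\<Sum>t<T. 2 * (\<Psi> t - \<Psi> (Suc t)) + 2 * \<theta>)" by (intro sum_mono step)
    also have "\<dots> = 2 * (\<Psi> 0 - \<Psi> T) + 2 * \<theta> * real T"
      unfolding sum.distrib sum_distrib_left[symmetric] sum_lessThan_telescope' by simp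
    finally show ?thesis .
  qed
  moreover have "potential d m (fst (St 0)) - potential d m (fst (St T))
        \<le> 12 * real d * (3 * (real m + 1) + 158 + 4 * ln (real d))"
      "potential d m (snd (St 0)) - potential d m (snd (St T))
        \<le> 12 * real d * (3 * (real m + 1) + 158 + 4 * ln (real d))"
    using inv[of 0] inv[of T] by (intro potential_range d; simp add: knowledge_set_def)+
  ultimately show ?thesis by (simp add: \<Psi>_def)
qed

text \<open>The tolerance \<open>1 / T\<close> costs only 2 in total, and \<open>m\<close> of order
  \<open>ln (ln T)\<close> levels suffice to reach it.\<close>

theorem theorem5p3:
  shows "\<exists>C T0. \<forall>d T. d \<ge> 1 \<longrightarrow> T \<ge> T0 \<longrightarrow>
     (\<exists>(M :: real measure) (alg :: real \<Rightarrow> policy).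
        prob_space M \<and>
        (\<forall>s b x. valid_instance d s b x \<longrightarrow>
           integrable M (\<lambda>w. total_profit d (alg w) s b x T) \<and>
           (\<forall>w\<in>space M. \<forall>t<T. fst (prices d (alg w) s b x t) \<le> snd (prices d (alg w) s b x t)) \<and>
           regret_inst d M alg s b x T \<le> C * (real d * ln (ln (real T)) + real d * ln (real d))))"
proof -
  \<comment> \<open>From \<open>exp (exp 1)\<close> on, \<open>ln (ln T) \<ge> 1\<close>, so
    additive constants are absorbed into \<open>d * ln (ln T)\<close>; from 6 on,
    \<open>ln 6 \<le> ln T\<close>, which absorbs the factor 6 in the condition on \<theta>.\<close>
  obtain T0 :: nat where T0: "max 6 (exp (exp 1)) \<le> real T0" using real_arch_simple by blast
  have main: "\<exists>(M :: real measure) (alg :: real \<Rightarrow> policy).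
        prob_space M \<and>
        (\<forall>s b x. valid_instance d s b x \<longrightarrow>
           integrable M (\<lambda>w. total_profit d (alg w) s b x T) \<and>
           (\<forall>w\<in>space M. \<forall>t<T. fst (prices d (alg w) s b x t) \<le> snd (prices d (alg w) s b x t)) \<and>
           regret_inst d M alg s b x T \<le> 10000 * (real d * ln (ln (real T)) + real d * ln (real d)))"
    if d: "1 \<le> d" and T: "T0 \<le> T" for d T
  proof -
    define l where "l = ln (ln (real T))"
    define m where "m = nat \<lceil>log 2 (ln (real T))\<rceil>"
    have T6: "6 \<le> real T" "exp (exp 1) \<le> real T" using T T0 by auto
    have "ln (exp (exp 1)) \<le> ln (real T)" using T6 by (intro ln_mono) auto
    then have lnT: "exp 1 \<le> ln (real T)" by simp
    then have lnT0: "0 < ln (real T)" by (smt (verit) exp_gt_zero)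
    have "ln (exp 1) \<le> ln (ln (real T))" using lnT by (intro ln_mono) auto
    then have l1: "1 \<le> l" by (simp add: l_def)
    have "ln (real T) \<le> 2 ^ m"
    proof -
      have "log 2 (ln (real T)) \<le> real m" unfolding m_def by linarith
      then have "ln (real T) \<le> 2 powr real m" using lnT0 by (simp add: log_le_iff)
      then show ?thesis by (simp add: powr_realpow)
    qed
    moreover have "ln 6 \<le> ln (real T)" using T6 by (intro ln_mono) auto
    ultimately have "ln 6 + ln (real T) \<le> 2 ^ Suc m" by simp
    then have "exp (- (2 ^ Suc m)) \<le> exp (- (ln 6 + ln (real T)))" by simp
    also have "\<dots> = 1 / (6 * real T)" unfolding exp_minus exp_add using T6 by (simp add: field_simps)
    finally have \<theta>: "6 * exp (- (2 ^ Suc m)) \<le> 1 / real T" by (simp add: field_simps)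
    have ml: "real m \<le> 2 * l + 1"
    proof -
      have "log 2 (ln (real T)) = l / ln 2" by (simp add: log_def l_def)
      also have "\<dots> \<le> l / (1 / 2)" using l1 ln2_ge_two_thirds by (intro divide_left_mono) auto
      finally have "log 2 (ln (real T)) \<le> 2 * l" by simp
      then show ?thesis unfolding m_def using l1 by linarith
    qed
    let ?pol = "trade_policy d m (1 / real T)"
    \<comment> \<open>The policy is deterministic: the seed space is a point mass and the
      expectation is the profit itself.\<close>
    define M :: "real measure" where "M = return borel 0"
    interpret M: prob_space M unfolding M_def by (rule prob_space_return) simp
    have "fst (prices d ?pol s b x t) \<le> snd (prices d ?pol s b x t)" for s b x t
      unfolding prices_def trade_policy_def by (simp add: split_beta quote_budget_balance)
    moreover have "regret_inst d M (\<lambda>_. ?pol) s b x T \<le> 10000 * (real d * ln (ln (real T)) + real d * ln (real d))"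
      if inst: "valid_instance d s b x" for s b x
    proof -
      have "regret_inst d M (\<lambda>_. ?pol) s b x T = total_gft d s b x T - total_profit d ?pol s b x T"
        by (simp add: regret_inst_def M.prob_space)
      also have "\<dots> \<le> 48 * real d * (3 * (real m + 1) + 158 + 4 * ln (real d)) + 2 * (1 / real T) * real T"
        by (rule regret_bound[OF d \<theta> inst])
      also have "\<dots> = 48 * real d * (3 * (real m + 1) + 158 + 4 * ln (real d)) + 2" using T6 by simp
      also have "\<dots> \<le> 48 * real d * (200 * l + 4 * ln (real d)) + 2 * (real d * l)"
      proof (intro add_mono mult_left_mono)
        \<comment> \<open>With \<open>m \<le> 2 * l + 1\<close> the left side is at most
          \<open>6 * l + 164\<close>, and \<open>1 \<le> l\<close>.\<close>
        show "3 * (real m + 1) + 158 \<le> 200 * l" using ml l1 by (smt (verit))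
        have "1 * 1 \<le> real d * l" using d l1 by (intro mult_mono) auto
        then show "2 \<le> 2 * (real d * l)" by simp
      qed simp_all
      also have "\<dots> \<le> 10000 * (real d * l + real d * ln (real d))"
      proof -
        have "0 \<le> real d * l" "0 \<le> real d * ln (real d)" using d l1 by auto
        then show ?thesis by (simp add: algebra_simps)
      qed
      finally show ?thesis by (simp add: l_def)
    qed
    ultimately show ?thesis
      by (intro exI[of _ M] exI[of _ "\<lambda>_. ?pol"]) (auto intro: M.prob_space_axioms)
  qed
  show ?thesis by (intro exI[of _ 10000] exI[of _ T0] allI impI) (rule main)
qed

end
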